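(* Consider an instance with type set $T=\{t_1,\dots,t_n\}$ and a credible agent. For any indefinite-stage mechanism $\Pi$, there exists an $\widetilde{\mathsf E}\mathsf{SES}$ mechanism $\Pi'$ that yields as much expected payoff for the principal as $\Pi$ does and has the following properties. (i) (IC at $\widetilde{\mathsf E}$) The root, an $\widetilde{\mathsf E}$ node, has $n$ children $\mathsf S_1,\dots,\mathsf S_n$, which are all $\mathsf S$ nodes. Each type-$t_i$ agent is incentivized to choose the branch leading to $\mathsf S_i$. (ii) (DIC at $\mathsf S_i$) Each node $\mathsf S_i$ has $n$ children $\mathsf E_{i1},\dots,\mathsf E_{in}$, all $\mathsf E$ nodes. Each $\mathsf E_{ij}$ is associated with type $t_j$, and at $\mathsf E_{ij}$ a type-$t_i$ agent is incentivized to report $t_j$. For each $k=1,\dots,n$, reporting type $t_k$ at $\mathsf E_{ij}$ leads to a child $\mathsf S_{ijk}$, which is an $\mathsf S$ node. (iii) (DIC at $\mathsf S_{ijk}$) The signaling strategy used at each node $\mathsf S_{ijk}$ directly recommends the agent an action to take (its signal set is $A$), and the recommended action is optimal for type $t_k$.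
   Context: An instance consists of finite sets $\Theta$ (states), $A$ (actions), $T$ (agent types), a prior $\mu\in\Delta(\Theta)$, a type distribution $\rho\in\Delta(T)$, a principal payoff function $v(\theta,a)$ and agent payoff functions $u_t(\theta,a)$, $t\in T$. The state $\theta\sim\mu$ is observed only by the principal; the agent's type $t\sim\rho$, independent of $\theta$, is known only to the agent. The principal commits to a mechanism; when action $a$ is finally played the principal gets $v(\theta,a)$ and an agent of true type $t$ gets $u_t(\theta,a)$. An indefinite-stage mechanism is a finite rooted tree with any number of stages (so it may be history-dependent), whose nodes are of the following kinds: - $\mathsf S$ node (signaling): it carries a strategy $\pi:\Theta\to\Delta(G)$ with $G$ finite, and has one child per signal in $G$; a signal $g\sim\pi(\cdot\mid\theta)$ is drawn and sent, and play moves to the child of $g$. - $\mathsf E$ node (binding elicitation): it has $|T|$ children, one per type; the agent reports a type $t'\in T$ and play moves to the corresponding child. (A credible agent's binding reports are consistent, so eliciting the type more than once on a path is redundant.) - $\widetilde{\mathsf E}$ node (non-binding elicitation): the agent selects one of its children and play moves there; this imposes no restriction on later behavior. - Leaf: the mechanism terminates and the agent plays an action. The agent knows the mechanism and observes the path. His posterior at a node is the Bayesian posterior on $\theta$ given the signals received. The agent is credible: at a leaf he must play an action maximizing expected payoff, under his posterior, of the type he reported at the $\mathsf E$ node on the path, even if it is not his true type; if no type elicitation took place on the path, he may choose an optimal action of any type. Subject to this, an agent of true type $t$ makes all choices to maximize his expected payoff under $u_t$. If there is a tie in the agent's decision-making (report, option or action), the mechanism decides how to break it; "incentivized to" means the choice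 is optimal for the agent (ties so broken). An $\widetilde{\mathsf E}\mathsf{SES}$ mechanism is one whose stages are, in order, $\widetilde{\mathsf E}$ (root), $\mathsf S$, $\mathsf E$, $\mathsf S$, then leaves. "IC" stands for incentive compatible and "DIC" for direct recommendation that is incentive compatible. *)

theory Defs
  imports "HOL-Probability.Probability_Mass_Function"
begin

text \<open>
  States, types and actions are finite types \<open>'s\<close>, \<open>'t\<close>, \<open>'a\<close>.  Signals and non-binding options are
  labels of arbitrary types \<open>'g\<close>, \<open>'o\<close>; every node carries the finite set of labels it uses, and
  only the children at these labels belong to the tree.
\<close>

datatype ('s, 't, 'g, 'o) mech =
    Leaf
  | Signal "'g set" "'s \<Rightarrow> 'g pmf" "'g \<Rightarrow> ('s, 't, 'g, 'o) mech"
  | Elicit "'t \<Rightarrow> ('s, 't, 'g, 'o) mech"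
  | Offer "'o set" "'o \<Rightarrow> ('s, 't, 'g, 'o) mech" \<comment> \<open>non-binding elicitation\<close>

primrec valid_mech :: "('s, 't, 'g, 'o) mech \<Rightarrow> bool" where
  "valid_mech Leaf \<longleftrightarrow> True"
| "valid_mech (Signal G \<pi> c) \<longleftrightarrow>
     finite G \<and> (\<forall>\<theta>. set_pmf (\<pi> \<theta>) \<subseteq> G) \<and> (\<forall>g\<in>G. valid_mech (c g))"
| "valid_mech (Elicit c) \<longleftrightarrow> (\<forall>t. valid_mech (c t))"
| "valid_mech (Offer X c) \<longleftrightarrow> finite X \<and> X \<noteq> {} \<and> (\<forall>x\<in>X. valid_mech (c x))"

definition ESES :: "('s, 't, 'g, 'o) mech \<Rightarrow> bool" where
  "ESES M \<longleftrightarrow>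
     (\<exists>X S. M = Offer X S \<and>
       (\<forall>x\<in>X. \<exists>G \<pi> E. S x = Signal G \<pi> E \<and>
         (\<forall>g\<in>G. \<exists>C. E g = Elicit C \<and>
           (\<forall>k. \<exists>G' \<pi>' L. C k = Signal G' \<pi>' L \<and> (\<forall>g'\<in>G'. L g' = Leaf)))))"

datatype ('t, 'g, 'o) move = Sent 'g | Reported 't | Chosen 'o

text \<open>
  A pure strategy of one agent type: what to report, choose or play after the observed path
  (a list of moves from the root).  Since it ranges over all optimal strategies below, it also
  encodes the mechanism's tie-breaking.
\<close>

datatype ('t, 'g, 'o, 'a) strategy = Strategy
  (report: "('t, 'g, 'o) move list \<Rightarrow> 't")
  (choice: "('t, 'g, 'o) move list \<Rightarrow> 'o")
  (act: "('t, 'g, 'o) move list \<Rightarrow> 'a")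

definition signal_prob :: "('s::finite \<Rightarrow> real) \<Rightarrow> ('s \<Rightarrow> 'g pmf) \<Rightarrow> 'g \<Rightarrow> real" where
  "signal_prob p \<pi> g = (\<Sum>\<theta>\<in>UNIV. p \<theta> * pmf (\<pi> \<theta>) g)"

text \<open>
  Bayes' rule.  After a signal of probability 0 there is no posterior; division by 0 then gives the
  zero function, which makes the agent indifferent between all his choices at such a node.
\<close>

definition posterior :: "('s::finite \<Rightarrow> real) \<Rightarrow> ('s \<Rightarrow> 'g pmf) \<Rightarrow> 'g \<Rightarrow> 's \<Rightarrow> real" where
  "posterior p \<pi> g \<theta> = p \<theta> * pmf (\<pi> \<theta>) g / signal_prob p \<pi> g"

definition exp_util :: "('s::finite \<Rightarrow> 'a \<Rightarrow> real) \<Rightarrow> ('s \<Rightarrow> real) \<Rightarrow> 'a \<Rightarrow> real" where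
  "exp_util f p a = (\<Sum>\<theta>\<in>UNIV. p \<theta> * f \<theta> a)"

definition optimal_actions :: "('s::finite \<Rightarrow> 'a \<Rightarrow> real) \<Rightarrow> ('s \<Rightarrow> real) \<Rightarrow> 'a set" where
  "optimal_actions f p = {a. \<forall>b. exp_util f p b \<le> exp_util f p a}"

text \<open>Actions a credible agent may play at a leaf; \<open>r\<close> is the type reported on the path, if any.\<close>

definition credible_actions ::
  "('t \<Rightarrow> 's::finite \<Rightarrow> 'a \<Rightarrow> real) \<Rightarrow> 't option \<Rightarrow> ('s \<Rightarrow> real) \<Rightarrow> 'a set" where
  "credible_actions u r p =
     (case r of Some k \<Rightarrow> optimal_actions (u k) p | None \<Rightarrow> (\<Union>k. optimal_actions (u k) p))"

text \<open>
  Expected payoff under payoff function \<open>f\<close> when play continues from the given node according to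
  strategy \<open>\<sigma>\<close>, after path \<open>h\<close>, with belief \<open>p\<close> and previously reported type \<open>r\<close>.  Binding reports
  are consistent: at a second \<open>Elicit\<close> node on a path the earlier report is repeated.
\<close>

primrec payoff ::
  "('s::finite \<Rightarrow> 'a \<Rightarrow> real) \<Rightarrow> ('t, 'g, 'o, 'a) strategy \<Rightarrow> ('s, 't, 'g, 'o) mech \<Rightarrow>
   ('t, 'g, 'o) move list \<Rightarrow> ('s \<Rightarrow> real) \<Rightarrow> 't option \<Rightarrow> real" where
  "payoff f \<sigma> Leaf h p r = exp_util f p (act \<sigma> h)"
| "payoff f \<sigma> (Signal G \<pi> c) h p r =
     (\<Sum>g\<in>G. signal_prob p \<pi> g * payoff f \<sigma> (c g) (h @ [Sent g]) (posterior p \<pi> g) r)"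
| "payoff f \<sigma> (Elicit c) h p r =
     (let k = (case r of Some k \<Rightarrow> k | None \<Rightarrow> report \<sigma> h)
      in payoff f \<sigma> (c k) (h @ [Reported k]) p (Some k))"
| "payoff f \<sigma> (Offer X c) h p r = payoff f \<sigma> (c (choice \<sigma> h)) (h @ [Chosen (choice \<sigma> h)]) p r"

text \<open>
  Optimality of \<open>\<sigma>\<close> for an agent of true type \<open>t\<close> at every node of the subtree (backward induction):
  each choice is best under \<open>u t\<close> among the available ones, given optimal behavior afterwards.
\<close>

primrec optimal_play ::
  "('t \<Rightarrow> 's::finite \<Rightarrow> 'a \<Rightarrow> real) \<Rightarrow> 't \<Rightarrow> ('t, 'g, 'o, 'a) strategy \<Rightarrow> ('s, 't, 'g, 'o) mech \<Rightarrow>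
   ('t, 'g, 'o) move list \<Rightarrow> ('s \<Rightarrow> real) \<Rightarrow> 't option \<Rightarrow> bool" where
  "optimal_play u t \<sigma> Leaf h p r \<longleftrightarrow>
     act \<sigma> h \<in> credible_actions u r p \<and>
     (\<forall>b\<in>credible_actions u r p. exp_util (u t) p b \<le> exp_util (u t) p (act \<sigma> h))"
| "optimal_play u t \<sigma> (Signal G \<pi> c) h p r \<longleftrightarrow>
     (\<forall>g\<in>G. optimal_play u t \<sigma> (c g) (h @ [Sent g]) (posterior p \<pi> g) r)"
| "optimal_play u t \<sigma> (Elicit c) h p r \<longleftrightarrow>
     (case r of
        Some k \<Rightarrow> optimal_play u t \<sigma> (c k) (h @ [Reported k]) p (Some k)
      | None \<Rightarrow>
          (\<forall>k. optimal_play u t \<sigma> (c k) (h @ [Reported k]) p (Some k) \<and>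
               payoff (u t) \<sigma> (c k) (h @ [Reported k]) p (Some k)
                 \<le> payoff (u t) \<sigma> (c (report \<sigma> h)) (h @ [Reported (report \<sigma> h)]) p
                     (Some (report \<sigma> h))))"
| "optimal_play u t \<sigma> (Offer X c) h p r \<longleftrightarrow>
     choice \<sigma> h \<in> X \<and>
     (\<forall>x\<in>X. optimal_play u t \<sigma> (c x) (h @ [Chosen x]) p r \<and>
            payoff (u t) \<sigma> (c x) (h @ [Chosen x]) p r
              \<le> payoff (u t) \<sigma> (c (choice \<sigma> h)) (h @ [Chosen (choice \<sigma> h)]) p r)"

definition optimal_strategies ::
  "'s::finite pmf \<Rightarrow> ('t \<Rightarrow> 's \<Rightarrow> 'a \<Rightarrow> real) \<Rightarrow> ('s, 't, 'g, 'o) mech \<Rightarrow>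
   ('t \<Rightarrow> ('t, 'g, 'o, 'a) strategy) \<Rightarrow> bool" where
  "optimal_strategies \<mu> u M \<sigma> \<longleftrightarrow> (\<forall>t. optimal_play u t (\<sigma> t) M [] (pmf \<mu>) None)"

definition principal_payoff ::
  "'s::finite pmf \<Rightarrow> 't::finite pmf \<Rightarrow> ('s \<Rightarrow> 'a \<Rightarrow> real) \<Rightarrow> ('s, 't, 'g, 'o) mech \<Rightarrow>
   ('t \<Rightarrow> ('t, 'g, 'o, 'a) strategy) \<Rightarrow> real" where
  "principal_payoff \<mu> \<rho> v M \<sigma> = (\<Sum>t\<in>UNIV. pmf \<rho> t * payoff v (\<sigma> t) M [] (pmf \<mu>) None)"

end

(*
  Each branch i of the new mechanism simulates type i in the given one: the signal at S_i is the report
  that type i would make there (its own type if it reaches a leaf without reporting), and after a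
  report of k the signal at S_ijk is the action that type i would finally play.  Pooling all nodes with
  the same report, and all leaves with the same action, loses nothing: the recommended action is
  optimal for k at each pooled leaf, so an action is optimal for k under the pooled belief iff it is so
  at each of these leaves.  Hence whatever a type t can do in branch i, it could do in the given
  mechanism by imitating type i up to the last choice, and it prefers its own branch.

  Beliefs are handled as unnormalised measures, in which pooling is addition; payoffs are
  homogeneous and optimality survives scaling by nonnegative factors, including the 0 that the junk
  posterior of a null signal produces.
*)

theory Submission
  imports Defs
begin

section \<open>Unnormalised beliefs\<close>

lemma exp_util_scale: "exp_util f (\<lambda>\<theta>. c * p \<theta>) a = c * exp_util f p a"
  by (simp add: exp_util_def sum_distrib_left mult.assoc)

lemma exp_util_zero [simp]: "exp_util f (\<lambda>\<theta>. 0) a = 0"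
  by (simp add: exp_util_def)

lemma exp_util_if:
  "exp_util f (if b then p else (\<lambda>\<theta>. 0)) a = (if b then exp_util f p a else 0)"
  by simp

lemma exp_util_sum: "exp_util f (\<lambda>\<theta>. \<Sum>g\<in>G. q g \<theta>) a = (\<Sum>g\<in>G. exp_util f (q g) a)"
  unfolding exp_util_def by (subst sum.swap) (simp add: sum_distrib_right)

lemma optimal_actions_zero [simp]: "optimal_actions f (\<lambda>\<theta>. 0) = UNIV"
  by (simp add: optimal_actions_def)

lemma optimal_actions_scale:
  assumes "0 < c"
  shows "optimal_actions f (\<lambda>\<theta>. c * p \<theta>) = optimal_actions f p"
  using assms by (simp add: optimal_actions_def exp_util_scale)

lemma optimal_actions_scaleI:
  assumes "0 \<le> c" "a \<in> optimal_actions f p"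
  shows "a \<in> optimal_actions f (\<lambda>\<theta>. c * p \<theta>)"
  using assms by (simp add: optimal_actions_def exp_util_scale mult_left_mono)

lemma credible_actions_scale:
  assumes "0 < c"
  shows "credible_actions u r (\<lambda>\<theta>. c * p \<theta>) = credible_actions u r p"
  using assms by (simp add: credible_actions_def optimal_actions_scale split: option.split)

lemma credible_actions_zero [simp]: "credible_actions u r (\<lambda>\<theta>. 0) = UNIV"
  by (simp add: credible_actions_def split: option.split)

lemma signal_prob_scale: "signal_prob (\<lambda>\<theta>. c * p \<theta>) \<pi> g = c * signal_prob p \<pi> g"
  by (simp add: signal_prob_def sum_distrib_left mult.assoc)

lemma signal_prob_nonneg: "(\<And>\<theta>. 0 \<le> p \<theta>) \<Longrightarrow> 0 \<le> signal_prob p \<pi> g"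
  by (simp add: signal_prob_def sum_nonneg)

lemma posterior_scale: "posterior (\<lambda>\<theta>. c * p \<theta>) \<pi> g = (\<lambda>\<theta>. of_bool (c \<noteq> 0) * posterior p \<pi> g \<theta>)"
  by (auto simp: posterior_def signal_prob_scale)

lemma posterior_eq_scaled:
  "posterior p \<pi> g = (\<lambda>\<theta>. 1 / signal_prob p \<pi> g * (p \<theta> * pmf (\<pi> \<theta>) g))"
  by (rule ext) (simp add: posterior_def)

text \<open>With \<open>p\<close> nonnegative, \<open>signal_prob\<close> vanishes only if each of
  its terms does, so undoing the normalisation is correct at null signals too.\<close>

lemma signal_prob_times_posterior:
  assumes "\<And>\<theta>. 0 \<le> p \<theta>"
  shows "signal_prob p \<pi> g * posterior p \<pi> g \<theta> = p \<theta> * pmf (\<pi> \<theta>) g"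
proof (cases "signal_prob p \<pi> g = 0")
  case True
  then have "p \<theta> * pmf (\<pi> \<theta>) g = 0"
    using assms unfolding signal_prob_def by (subst (asm) sum_nonneg_eq_0_iff) auto
  with True show ?thesis by simp
qed (simp add: posterior_def)

text \<open>A strategy reads the path and never the belief, so the moves stay the same. At
  \<open>Signal\<close> the factor comes out of \<open>signal_prob\<close>, which absorbs the
  indicator from \<open>posterior_scale\<close>.\<close>

lemma payoff_scale: "payoff f \<sigma> M h (\<lambda>\<theta>. c * p \<theta>) r = c * payoff f \<sigma> M h p r"
proof (induction M arbitrary: h p r c)
  case (Signal G \<pi> M)
  then show ?case
    by (simp add: signal_prob_scale posterior_scale sum_distrib_left mult.assoc)
qed (auto simp: exp_util_scale Let_def split: option.split)

text \<open>For \<open>c = 0\<close> every action is credible and all payoffs vanish; for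
  \<open>c > 0\<close> all comparisons are preserved.\<close>

lemma optimal_play_scale:
  assumes "0 \<le> c" "optimal_play u t \<sigma> M h p r"
  shows "optimal_play u t \<sigma> M h (\<lambda>\<theta>. c * p \<theta>) r"
  using assms
proof (induction M arbitrary: h p r c)
  case Leaf
  then show ?case
    by (cases "c = 0") (auto simp: exp_util_scale credible_actions_scale)
next
  case (Signal G \<pi> M)
  then show ?case by (auto simp: posterior_scale)
next
  case (Elicit M)
  then show ?case by (auto simp: payoff_scale mult_left_mono split: option.splits)
next
  case (Offer X M)
  then show ?case by (auto simp: payoff_scale mult_left_mono)
qed

lemma payoff_Signal:
  assumes "\<And>\<theta>. 0 \<le> p \<theta>"
  shows "payoff f \<sigma> (Signal G \<pi> M) h p r =
    (\<Sum>g\<in>G. payoff f \<sigma> (M g) (h @ [Sent g]) (\<lambda>\<theta>. p \<theta> * pmf (\<pi> \<theta>) g) r)"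
  unfolding payoff.simps by (simp only: payoff_scale[symmetric] signal_prob_times_posterior[OF assms])

text \<open>Posterior and joint measure are nonnegative multiples of each other; at a null signal
  both are zero. Inductions can thus carry joint measures, which add up over signals.\<close>

lemma optimal_play_Signal:
  assumes "\<And>\<theta>. 0 \<le> p \<theta>"
  shows "optimal_play u t \<sigma> (Signal G \<pi> M) h p r \<longleftrightarrow>
    (\<forall>g\<in>G. optimal_play u t \<sigma> (M g) (h @ [Sent g]) (\<lambda>\<theta>. p \<theta> * pmf (\<pi> \<theta>) g) r)"
proof -
  have "optimal_play u t \<sigma> (M g) h' (posterior p \<pi> g) r \<longleftrightarrow>
        optimal_play u t \<sigma> (M g) h' (\<lambda>\<theta>. p \<theta> * pmf (\<pi> \<theta>) g) r" for g h'
  proof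
    assume "optimal_play u t \<sigma> (M g) h' (posterior p \<pi> g) r"
    from optimal_play_scale[OF signal_prob_nonneg[of p \<pi> g, OF assms] this]
    show "optimal_play u t \<sigma> (M g) h' (\<lambda>\<theta>. p \<theta> * pmf (\<pi> \<theta>) g) r"
      by (simp add: signal_prob_times_posterior assms)
  next
    assume "optimal_play u t \<sigma> (M g) h' (\<lambda>\<theta>. p \<theta> * pmf (\<pi> \<theta>) g) r"
    then show "optimal_play u t \<sigma> (M g) h' (posterior p \<pi> g) r"
      unfolding posterior_eq_scaled
      by (rule optimal_play_scale[rotated]) (simp add: signal_prob_nonneg assms)
  qed
  then show ?thesis by simp
qed

lemma optimal_actions_posterior:
  assumes "\<And>\<theta>. 0 \<le> p \<theta>" "a \<in> optimal_actions f (\<lambda>\<theta>. p \<theta> * pmf (\<pi> \<theta>) g)"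
  shows "a \<in> optimal_actions f (posterior p \<pi> g)"
  unfolding posterior_eq_scaled
  using assms by (intro optimal_actions_scaleI) (auto simp: signal_prob_nonneg)

lemma posterior_nonneg: "(\<And>\<theta>. 0 \<le> p \<theta>) \<Longrightarrow> 0 \<le> posterior p \<pi> g \<theta>"
  by (simp add: posterior_def signal_prob_nonneg)

lemma sum_times_pmf:
  assumes "finite G" "set_pmf P \<subseteq> G"
  shows "(\<Sum>g\<in>G. x * pmf P g) = x"
  using sum_pmf_eq_1[OF assms] by (simp flip: sum_distrib_left)

text \<open>Divide by \<open>q \<theta>\<close>; where this is 0, all \<open>w g \<theta>\<close>
  vanish and any distribution serves.\<close>

lemma kernel_of_decomposition:
  fixes q :: "'s \<Rightarrow> real" and w :: "'g::finite \<Rightarrow> 's \<Rightarrow> real"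
  assumes nonneg: "\<And>g \<theta>. 0 \<le> w g \<theta>" and total: "\<And>\<theta>. (\<Sum>g\<in>UNIV. w g \<theta>) = q \<theta>"
  obtains \<pi> :: "'s \<Rightarrow> 'g pmf" where "\<And>\<theta> g. q \<theta> * pmf (\<pi> \<theta>) g = w g \<theta>"
proof -
  have "\<exists>P. \<forall>g. q \<theta> * pmf P g = w g \<theta>" for \<theta>
  proof (cases "q \<theta> = 0")
    case True
    then have "w g \<theta> = 0" for g
      using total[of \<theta>] nonneg by (simp add: sum_nonneg_eq_0_iff)
    with True show ?thesis by simp
  next
    case False
    have pos: "0 \<le> q \<theta>" by (simp add: nonneg sum_nonneg flip: total)
    let ?P = "embed_pmf (\<lambda>g. w g \<theta> / q \<theta>)"
    have "(\<Sum>g\<in>UNIV. w g \<theta> / q \<theta>) = 1"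
      using False total[of \<theta>] by (simp flip: sum_divide_distrib)
    then have "(\<integral>\<^sup>+g. ennreal (w g \<theta> / q \<theta>) \<partial>count_space UNIV) = 1"
      by (simp add: nn_integral_count_space_finite nonneg pos)
    then have "pmf ?P g = w g \<theta> / q \<theta>" for g
      by (intro pmf_embed_pmf) (auto simp: nonneg pos)
    with False show ?thesis by (intro exI[of _ ?P]) simp
  qed
  then have "\<forall>\<theta>. \<exists>P. \<forall>g. q \<theta> * pmf P g = w g \<theta>" by blast
  from choice[OF this] obtain \<pi> where "\<forall>\<theta> g. q \<theta> * pmf (\<pi> \<theta>) g = w g \<theta>" by blast
  then show thesis by (intro that[of \<pi>]) auto
qed

section \<open>Pooling\<close>

text \<open>These are exactly the leaf actions that \<open>optimal_play\<close> allows a true type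
  \<open>t\<close> bound by a report of \<open>k\<close>.\<close>

definition favored_actions ::
  "('t \<Rightarrow> 's::finite \<Rightarrow> 'a \<Rightarrow> real) \<Rightarrow> 't \<Rightarrow> 't \<Rightarrow> ('s \<Rightarrow> real) \<Rightarrow> 'a set" where
  "favored_actions u t k q = {a \<in> optimal_actions (u k) q.
     \<forall>b\<in>optimal_actions (u k) q. exp_util (u t) q b \<le> exp_util (u t) q a}"

lemma favored_actions_optimal: "a \<in> favored_actions u t k q \<Longrightarrow> a \<in> optimal_actions (u k) q"
  by (simp add: favored_actions_def)

lemma favored_actions_self: "a \<in> optimal_actions (u k) q \<Longrightarrow> a \<in> favored_actions u k k q"
  by (auto simp: favored_actions_def optimal_actions_def)

lemma favored_actions_zero [simp]: "favored_actions u t k (\<lambda>\<theta>. 0) = UNIV"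
  by (simp add: favored_actions_def)

lemma ex_maximal:
  fixes f :: "'x \<Rightarrow> real"
  assumes "finite X" "X \<noteq> {}"
  shows "\<exists>x\<in>X. \<forall>y\<in>X. f y \<le> f x"
proof -
  have "Max (f ` X) \<in> f ` X" using assms by simp
  then obtain x where "x \<in> X" "f x = Max (f ` X)" by auto
  with assms show ?thesis by (metis Max_ge finite_imageI imageI)
qed

lemma optimal_actions_nonempty: "optimal_actions f (q :: 's::finite \<Rightarrow> real) \<noteq> ({} :: 'a::finite set)"
  using ex_maximal[of "UNIV :: 'a set" "exp_util f q"] by (auto simp: optimal_actions_def)

lemma favored_actions_nonempty:
  "favored_actions u t k (q :: 's::finite \<Rightarrow> real) \<noteq> ({} :: 'a::finite set)"
  using ex_maximal[OF finite[of "optimal_actions (u k) q"] optimal_actions_nonempty, of "exp_util (u t) q"]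
  by (auto simp: favored_actions_def)

lemma optimal_actions_sum:
  assumes "\<And>g. g \<in> G \<Longrightarrow> a \<in> optimal_actions f (q g)"
  shows "a \<in> optimal_actions f (\<lambda>\<theta>. \<Sum>g\<in>G. q g \<theta>)"
  using assms by (auto simp: optimal_actions_def exp_util_sum intro!: sum_mono)

text \<open>The common maximiser \<open>a\<close> makes the shortfall of \<open>b\<close>
  nonnegative on every part. The shortfalls sum to 0, so each of them is 0.\<close>

lemma optimal_actions_of_sum:
  assumes "finite G" and a: "\<And>g. g \<in> G \<Longrightarrow> a \<in> optimal_actions f (q g)"
    and b: "b \<in> optimal_actions f (\<lambda>\<theta>. \<Sum>g\<in>G. q g \<theta>)" and "g \<in> G"
  shows "b \<in> optimal_actions f (q g)"
proof -
  have le: "exp_util f (q g) b \<le> exp_util f (q g) a" if "g \<in> G" for g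
    using a[OF that] by (simp add: optimal_actions_def)
  have "(\<Sum>g\<in>G. exp_util f (q g) a) \<le> (\<Sum>g\<in>G. exp_util f (q g) b)"
    using b by (simp add: optimal_actions_def exp_util_sum)
  then have "(\<Sum>g\<in>G. exp_util f (q g) a - exp_util f (q g) b) = 0"
    using sum_mono[of G "\<lambda>g. exp_util f (q g) b" "\<lambda>g. exp_util f (q g) a", OF le] by (simp add: sum_subtractf)
  then have "exp_util f (q g) b = exp_util f (q g) a"
    using assms(1) \<open>g \<in> G\<close> le by (subst (asm) sum_nonneg_eq_0_iff) auto
  with a[OF \<open>g \<in> G\<close>] show ?thesis by (simp add: optimal_actions_def)
qed

text \<open>A rival that is optimal for \<open>k\<close> on the pool is so on each part, where
  \<open>a\<close> already beats it for \<open>t\<close>.\<close>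

lemma favored_actions_sum:
  assumes "finite G" "\<And>g. g \<in> G \<Longrightarrow> a \<in> favored_actions u t k (q g)"
  shows "a \<in> favored_actions u t k (\<lambda>\<theta>. \<Sum>g\<in>G. q g \<theta>)"
proof -
  have opt: "a \<in> optimal_actions (u k) (q g)" if "g \<in> G" for g
    using assms(2)[OF that] by (rule favored_actions_optimal)
  have "exp_util (u t) (\<lambda>\<theta>. \<Sum>g\<in>G. q g \<theta>) b \<le> exp_util (u t) (\<lambda>\<theta>. \<Sum>g\<in>G. q g \<theta>) a"
    if "b \<in> optimal_actions (u k) (\<lambda>\<theta>. \<Sum>g\<in>G. q g \<theta>)" for b
    unfolding exp_util_sum
  proof (rule sum_mono)
    fix g assume g: "g \<in> G"
    have "b \<in> optimal_actions (u k) (q g)"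
      using assms(1) opt that g by (rule optimal_actions_of_sum)
    with assms(2)[OF g] show "exp_util (u t) (q g) b \<le> exp_util (u t) (q g) a"
      by (simp add: favored_actions_def)
  qed
  with optimal_actions_sum[OF opt] show ?thesis by (simp add: favored_actions_def)
qed

text \<open>
  \<open>P a\<close> is the part of the measure \<open>q\<close> on which \<open>a\<close> is recommended after type \<open>i\<close> has reported \<open>k\<close>;
  \<open>V t f\<close> stands for the \<open>f\<close>-payoff of type \<open>t\<close> at the simulated node.  The last condition says that
  no type gains there by imitating type \<open>i\<close> and reinterpreting the recommendations.
\<close>

definition direct ::
  "('t \<Rightarrow> 's::finite \<Rightarrow> 'a::finite \<Rightarrow> real) \<Rightarrow> 't \<Rightarrow> 't \<Rightarrow> ('s \<Rightarrow> real) \<Rightarrow> ('a \<Rightarrow> 's \<Rightarrow> real) \<Rightarrow>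
   ('t \<Rightarrow> ('s \<Rightarrow> 'a \<Rightarrow> real) \<Rightarrow> real) \<Rightarrow> bool" where
  "direct u i k q P V \<longleftrightarrow>
     (\<forall>a \<theta>. 0 \<le> P a \<theta>) \<and> (\<forall>\<theta>. (\<Sum>a\<in>UNIV. P a \<theta>) = q \<theta>) \<and>
     (\<forall>f. V i f = (\<Sum>a\<in>UNIV. exp_util f (P a) a)) \<and>
     (\<forall>a. a \<in> favored_actions u i k (P a)) \<and>
     (\<forall>t \<beta>. (\<forall>a. \<beta> a \<in> optimal_actions (u k) (P a)) \<longrightarrow>
        (\<Sum>a\<in>UNIV. exp_util (u t) (P a) (\<beta> a)) \<le> V t (u t))"

lemma direct_zero: "direct u i k (\<lambda>\<theta>. 0) (\<lambda>a \<theta>. 0) (\<lambda>t f. 0)"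
  by (simp add: direct_def)

text \<open>Serves \<open>Offer\<close> nodes: the simulation follows the option of type
  \<open>i\<close>, and replacing it by each type's own choice can only raise the bound.\<close>

lemma direct_mono:
  assumes "direct u i k q P V" "\<And>f. V i f = V' i f" "\<And>t. V t (u t) \<le> V' t (u t)"
  shows "direct u i k q P V'"
  using assms unfolding direct_def by (simp, meson order_trans)

lemma if_apply: "(if b then f else g) x = (if b then f x else g x)"
  by simp

text \<open>All other recommendations carry the zero measure, under which every action is
  favored.\<close>

lemma direct_single:
  assumes "\<And>\<theta>. 0 \<le> q \<theta>" "a \<in> favored_actions u i k q" "\<And>f. V i f = exp_util f q a"
    and "\<And>t b. b \<in> optimal_actions (u k) q \<Longrightarrow> exp_util (u t) q b \<le> V t (u t)"
  shows "direct u i k q (\<lambda>b. if b = a then q else (\<lambda>\<theta>. 0)) V"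
  unfolding direct_def using assms by (auto simp: if_apply exp_util_if)

lemma direct_sum:
  assumes "finite G" and d: "\<And>g. g \<in> G \<Longrightarrow> direct u i k (q g) (P g) (V g)"
  shows "direct u i k (\<lambda>\<theta>. \<Sum>g\<in>G. q g \<theta>) (\<lambda>a \<theta>. \<Sum>g\<in>G. P g a \<theta>) (\<lambda>t f. \<Sum>g\<in>G. V g t f)"
  unfolding direct_def
proof (intro conjI allI impI)
  show "0 \<le> (\<Sum>g\<in>G. P g a \<theta>)" for a \<theta>
    using d by (auto simp: direct_def intro: sum_nonneg)
  show "(\<Sum>a\<in>UNIV. \<Sum>g\<in>G. P g a \<theta>) = (\<Sum>g\<in>G. q g \<theta>)" for \<theta>
    using d by (subst sum.swap) (simp add: direct_def)
  show "(\<Sum>g\<in>G. V g i f) = (\<Sum>a\<in>UNIV. exp_util f (\<lambda>\<theta>. \<Sum>g\<in>G. P g a \<theta>) a)" for f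
    using d by (simp add: exp_util_sum, subst sum.swap) (simp add: direct_def)
  show "a \<in> favored_actions u i k (\<lambda>\<theta>. \<Sum>g\<in>G. P g a \<theta>)" for a
    using assms(1) d by (auto simp: direct_def intro: favored_actions_sum)
next
  fix t \<beta>
  assume \<beta>: "\<forall>a. \<beta> a \<in> optimal_actions (u k) (\<lambda>\<theta>. \<Sum>g\<in>G. P g a \<theta>)"
  \<comment> \<open>The recommendation \<open>a\<close> is itself the maximiser common to all
    parts.\<close>
  have "\<beta> a \<in> optimal_actions (u k) (P g a)" if g: "g \<in> G" for g a
  proof (rule optimal_actions_of_sum[where g = g and G = G and q = "\<lambda>g. P g a"])
    show "a \<in> optimal_actions (u k) (P g a)" if "g \<in> G" for g
      using d[OF that] by (auto simp: direct_def intro: favored_actions_optimal)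
  qed (use assms(1) \<beta> g in auto)
  then have "(\<Sum>a\<in>UNIV. exp_util (u t) (P g a) (\<beta> a)) \<le> V g t (u t)" if "g \<in> G" for g
    using d[OF that] that by (simp add: direct_def)
  then have "(\<Sum>g\<in>G. \<Sum>a\<in>UNIV. exp_util (u t) (P g a) (\<beta> a)) \<le> (\<Sum>g\<in>G. V g t (u t))"
    by (rule sum_mono)
  then show "(\<Sum>a\<in>UNIV. exp_util (u t) (\<lambda>\<theta>. \<Sum>g\<in>G. P g a \<theta>) (\<beta> a)) \<le> (\<Sum>g\<in>G. V g t (u t))"
    by (subst (asm) sum.swap) (simp add: exp_util_sum)
qed

text \<open>
  \<open>R j\<close> is the part of \<open>q\<close> on which type \<open>i\<close> reports \<open>j\<close> in the simulated mechanism, and \<open>P j k\<close>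
  describes the recommendations there after a report of \<open>k\<close> instead.
\<close>

definition two_stage ::
  "('t::finite \<Rightarrow> 's::finite \<Rightarrow> 'a::finite \<Rightarrow> real) \<Rightarrow> 't \<Rightarrow> ('s \<Rightarrow> real) \<Rightarrow> ('t \<Rightarrow> 's \<Rightarrow> real) \<Rightarrow>
   ('t \<Rightarrow> 't \<Rightarrow> 'a \<Rightarrow> 's \<Rightarrow> real) \<Rightarrow> ('t \<Rightarrow> 't \<Rightarrow> 't \<Rightarrow> ('s \<Rightarrow> 'a \<Rightarrow> real) \<Rightarrow> real) \<Rightarrow>
   ('t \<Rightarrow> ('s \<Rightarrow> 'a \<Rightarrow> real) \<Rightarrow> real) \<Rightarrow> bool" where
  "two_stage u i q R P W V \<longleftrightarrow>
     (\<forall>j \<theta>. 0 \<le> R j \<theta>) \<and> (\<forall>\<theta>. (\<Sum>j\<in>UNIV. R j \<theta>) = q \<theta>) \<and>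
     (\<forall>j k. direct u i k (R j) (P j k) (W j k)) \<and>
     (\<forall>f. V i f = (\<Sum>j\<in>UNIV. W j j i f)) \<and>
     (\<forall>j k. W j k i (u i) \<le> W j j i (u i)) \<and>
     (\<forall>t \<kappa>. (\<Sum>j\<in>UNIV. W j (\<kappa> j) t (u t)) \<le> V t (u t))"

lemma two_stage_mono:
  assumes "two_stage u i q R P W V" "\<And>f. V i f = V' i f" "\<And>t. V t (u t) \<le> V' t (u t)"
  shows "two_stage u i q R P W V'"
  using assms unfolding two_stage_def by (simp, meson order_trans)

text \<open>Covers a node where type \<open>i\<close> makes one fixed report \<open>l\<close>; all
  other reports carry the zero measure.\<close>

lemma two_stage_single:
  assumes "\<And>\<theta>. 0 \<le> q \<theta>" "\<And>k. direct u i k q (P k) (W k)"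
    and "\<And>f. V i f = W l i f" "\<And>k. W k i (u i) \<le> W l i (u i)" "\<And>t k. W k t (u t) \<le> V t (u t)"
  shows "two_stage u i q (\<lambda>j. if j = l then q else (\<lambda>\<theta>. 0))
    (\<lambda>j k. if j = l then P k else (\<lambda>a \<theta>. 0)) (\<lambda>j k. if j = l then W k else (\<lambda>t f. 0)) V"
  unfolding two_stage_def using assms by (simp add: direct_zero if_apply)

text \<open>Pooling only restricts a deviator: \<open>\<kappa>\<close> must answer \<open>j\<close>
  in the same way for all \<open>g\<close>.\<close>

lemma two_stage_sum:
  assumes "finite G" and d: "\<And>g. g \<in> G \<Longrightarrow> two_stage u i (q g) (R g) (P g) (W g) (V g)"
  shows "two_stage u i (\<lambda>\<theta>. \<Sum>g\<in>G. q g \<theta>) (\<lambda>j \<theta>. \<Sum>g\<in>G. R g j \<theta>) (\<lambda>j k a \<theta>. \<Sum>g\<in>G. P g j k a \<theta>)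
    (\<lambda>j k t f. \<Sum>g\<in>G. W g j k t f) (\<lambda>t f. \<Sum>g\<in>G. V g t f)"
  unfolding two_stage_def
proof (intro conjI allI)
  show "0 \<le> (\<Sum>g\<in>G. R g j \<theta>)" for j \<theta>
    using d by (auto simp: two_stage_def intro: sum_nonneg)
  show "(\<Sum>j\<in>UNIV. \<Sum>g\<in>G. R g j \<theta>) = (\<Sum>g\<in>G. q g \<theta>)" for \<theta>
    using d by (subst sum.swap) (simp add: two_stage_def)
  show "direct u i k (\<lambda>\<theta>. \<Sum>g\<in>G. R g j \<theta>) (\<lambda>a \<theta>. \<Sum>g\<in>G. P g j k a \<theta>) (\<lambda>t f. \<Sum>g\<in>G. W g j k t f)" for j k
    using d assms(1) by (intro direct_sum) (auto simp: two_stage_def)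
  show "(\<Sum>g\<in>G. V g i f) = (\<Sum>j\<in>UNIV. \<Sum>g\<in>G. W g j j i f)" for f
    using d by (subst sum.swap) (simp add: two_stage_def)
  show "(\<Sum>g\<in>G. W g j k i (u i)) \<le> (\<Sum>g\<in>G. W g j j i (u i))" for j k
    using d by (auto simp: two_stage_def intro: sum_mono)
  show "(\<Sum>j\<in>UNIV. \<Sum>g\<in>G. W g j (\<kappa> j) t (u t)) \<le> (\<Sum>g\<in>G. V g t (u t))" for t \<kappa>
    using d by (subst sum.swap) (auto simp: two_stage_def intro: sum_mono)
qed

section \<open>Simulating a mechanism\<close>

text \<open>Simulates a subtree below a binding report of \<open>k\<close>, with signals pooled and
  options chosen as type \<open>i\<close> chooses them.\<close>

lemma ex_direct:
  fixes \<sigma> :: "'t \<Rightarrow> ('t, 'g, 'o, 'a::finite) strategy" and q :: "'s::finite \<Rightarrow> real"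
  assumes "valid_mech M" "\<And>\<theta>. 0 \<le> q \<theta>" "\<And>t. optimal_play u t (\<sigma> t) M h q (Some k)"
  shows "\<exists>P. direct u i k q P (\<lambda>t f. payoff f (\<sigma> t) M h q (Some k))"
  using assms
proof (induction M arbitrary: h q)
  case Leaf
  have fav: "act (\<sigma> t) h \<in> favored_actions u t k q" for t
    using Leaf(3)[of t] by (simp add: favored_actions_def credible_actions_def)
  have "direct u i k q (\<lambda>a. if a = act (\<sigma> i) h then q else (\<lambda>\<theta>. 0))
      (\<lambda>t f. payoff f (\<sigma> t) Leaf h q (Some k))"
    using Leaf(2) fav by (intro direct_single) (auto simp: favored_actions_def)
  then show ?case by blast
next
  case (Signal G \<pi> M)
  let ?q = "\<lambda>g \<theta>. q \<theta> * pmf (\<pi> \<theta>) g"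
  let ?V = "\<lambda>g t f. payoff f (\<sigma> t) (M g) (h @ [Sent g]) (?q g) (Some k)"
  have fin: "finite G" using Signal.prems(1) by simp
  have "\<exists>P. direct u i k (?q g) P (?V g)" if "g \<in> G" for g
    using Signal.prems that
    by (intro Signal.IH) (auto simp: optimal_play_Signal simp del: optimal_play.simps)
  then have "\<forall>g\<in>G. \<exists>P. direct u i k (?q g) P (?V g)" by blast
  from bchoice[OF this] obtain P where P: "\<forall>g\<in>G. direct u i k (?q g) (P g) (?V g)" ..
  have "direct u i k (\<lambda>\<theta>. \<Sum>g\<in>G. ?q g \<theta>) (\<lambda>a \<theta>. \<Sum>g\<in>G. P g a \<theta>) (\<lambda>t f. \<Sum>g\<in>G. ?V g t f)"
    using fin P by (intro direct_sum) auto
  then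
  have "direct u i k q (\<lambda>a \<theta>. \<Sum>g\<in>G. P g a \<theta>) (\<lambda>t f. payoff f (\<sigma> t) (Signal G \<pi> M) h q (Some k))"
    using Signal.prems fin by (simp add: sum_times_pmf payoff_Signal del: payoff.simps)
  then show ?case by blast
next
  case (Elicit M)
  have "\<exists>P. direct u i k q P (\<lambda>t f. payoff f (\<sigma> t) (M k) (h @ [Reported k]) q (Some k))"
    using Elicit.prems by (intro Elicit.IH) auto
  then show ?case by simp
next
  case (Offer X M)
  let ?x = "choice (\<sigma> i) h"
  have x: "?x \<in> X" using Offer.prems(3)[of i] by simp
  have "\<exists>P. direct u i k q P (\<lambda>t f. payoff f (\<sigma> t) (M ?x) (h @ [Chosen ?x]) q (Some k))"
    using Offer.prems x by (intro Offer.IH) auto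
  then obtain P where "direct u i k q P (\<lambda>t f. payoff f (\<sigma> t) (M ?x) (h @ [Chosen ?x]) q (Some k))"
    by blast
  then have "direct u i k q P (\<lambda>t f. payoff f (\<sigma> t) (Offer X M) h q (Some k))"
    by (rule direct_mono) (use Offer.prems(3) x in auto)
  then show ?case by blast
qed

text \<open>Simulates a subtree before any report. An \<open>Elicit\<close> node hands over to
  \<open>ex_direct\<close>; a leaf is treated as if type \<open>i\<close> reported itself
  there.\<close>

lemma ex_two_stage:
  fixes \<sigma> :: "'t::finite \<Rightarrow> ('t, 'g, 'o, 'a::finite) strategy" and q :: "'s::finite \<Rightarrow> real"
  assumes "valid_mech M" "\<And>\<theta>. 0 \<le> q \<theta>" "\<And>t. optimal_play u t (\<sigma> t) M h q None"
  shows "\<exists>R P W. two_stage u i q R P W (\<lambda>t f. payoff f (\<sigma> t) M h q None)"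
  using assms
proof (induction M arbitrary: h q)
  case Leaf
  let ?act = "\<lambda>t. act (\<sigma> t) h"
  have best: "exp_util (u t) q b \<le> exp_util (u t) q (?act t)"
    if "b \<in> optimal_actions (u k) q" for t k b
    using Leaf(3)[of t] that by (auto simp: credible_actions_def)
  \<comment> \<open>Without a report, the optimal actions of type \<open>t\<close> itself are among
    the credible ones.\<close>
  have own: "?act t \<in> optimal_actions (u t) q" for t
  proof -
    obtain b where "b \<in> optimal_actions (u t) q" using optimal_actions_nonempty by blast
    with best[OF this, of t] show ?thesis by (auto simp: optimal_actions_def intro: order_trans)
  qed
  \<comment> \<open>After the report \<open>i\<close> the recommendation must be the action really
    played, so that payoffs agree for every \<open>f\<close>.\<close>
  have "\<exists>a. a \<in> favored_actions u i k q \<and> (k = i \<longrightarrow> a = ?act i)" for k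
    using favored_actions_self[of "?act i" u i q, OF own] favored_actions_nonempty[of u i k q] by auto
  then obtain \<alpha> where \<alpha>: "\<And>k. \<alpha> k \<in> favored_actions u i k q" "\<alpha> i = ?act i" by metis
  \<comment> \<open>For type \<open>i\<close> this must be the exact payoff; for other types an
    upper bound suffices, and their unrestricted best action gives one.\<close>
  let ?W = "\<lambda>k t f. exp_util f q (if t = i then \<alpha> k else ?act t)"
  have "direct u i k q (\<lambda>a. if a = \<alpha> k then q else (\<lambda>\<theta>. 0)) (?W k)" for k
    using Leaf(2) \<alpha>(1)[of k] best by (intro direct_single) (auto simp: favored_actions_def)
  moreover have le: "exp_util (u t) q (\<alpha> k) \<le> exp_util (u t) q (?act t)" for k t
    using best[OF favored_actions_optimal[OF \<alpha>(1)]] .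
  ultimately show ?case
    using \<alpha>(2) Leaf(2)
    by (intro exI) (rule two_stage_single[where l = i and W = ?W and
        P = "\<lambda>k a. if a = \<alpha> k then q else (\<lambda>\<theta>. 0)"]; simp add: le)
next
  case (Signal G \<pi> M)
  let ?q = "\<lambda>g \<theta>. q \<theta> * pmf (\<pi> \<theta>) g"
  let ?V = "\<lambda>g t f. payoff f (\<sigma> t) (M g) (h @ [Sent g]) (?q g) None"
  have fin: "finite G" using Signal.prems(1) by simp
  have "\<exists>R P W. two_stage u i (?q g) R P W (?V g)" if "g \<in> G" for g
    using Signal.prems that
    by (intro Signal.IH) (auto simp: optimal_play_Signal simp del: optimal_play.simps)
  then have "\<forall>g\<in>G. \<exists>R P W. two_stage u i (?q g) R P W (?V g)" by blast
  then obtain R P W where RPW: "\<forall>g\<in>G. two_stage u i (?q g) (R g) (P g) (W g) (?V g)"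
    unfolding bchoice_iff by blast
  have "two_stage u i (\<lambda>\<theta>. \<Sum>g\<in>G. ?q g \<theta>) (\<lambda>j \<theta>. \<Sum>g\<in>G. R g j \<theta>)
      (\<lambda>j k a \<theta>. \<Sum>g\<in>G. P g j k a \<theta>) (\<lambda>j k t f. \<Sum>g\<in>G. W g j k t f) (\<lambda>t f. \<Sum>g\<in>G. ?V g t f)"
    using fin RPW by (intro two_stage_sum) auto
  then
  have "two_stage u i q (\<lambda>j \<theta>. \<Sum>g\<in>G. R g j \<theta>) (\<lambda>j k a \<theta>. \<Sum>g\<in>G. P g j k a \<theta>)
      (\<lambda>j k t f. \<Sum>g\<in>G. W g j k t f) (\<lambda>t f. payoff f (\<sigma> t) (Signal G \<pi> M) h q None)"
    using Signal.prems fin by (simp add: sum_times_pmf payoff_Signal del: payoff.simps)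
  then show ?case by blast
next
  case (Elicit M)
  let ?W = "\<lambda>k t f. payoff f (\<sigma> t) (M k) (h @ [Reported k]) q (Some k)"
  have opt: "optimal_play u t (\<sigma> t) (M k) (h @ [Reported k]) q (Some k)" for t k
    using Elicit.prems(3)[of t] by simp
  have "\<exists>P. direct u i k q P (?W k)" for k
    using Elicit.prems opt by (intro ex_direct) auto
  then obtain P where "\<And>k. direct u i k q (P k) (?W k)" by metis
  then show ?case
    using Elicit.prems
    by (intro exI) (rule two_stage_single[where l = "report (\<sigma> i) h" and W = ?W and P = P]; simp add: Let_def)
next
  case (Offer X M)
  let ?x = "choice (\<sigma> i) h"
  have x: "?x \<in> X" using Offer.prems(3)[of i] by simp
  have "\<exists>R P W. two_stage u i q R P W (\<lambda>t f. payoff f (\<sigma> t) (M ?x) (h @ [Chosen ?x]) q None)"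
    using Offer.prems x by (intro Offer.IH) auto
  then obtain R P W where
    "two_stage u i q R P W (\<lambda>t f. payoff f (\<sigma> t) (M ?x) (h @ [Chosen ?x]) q None)"
    by blast
  then have "two_stage u i q R P W (\<lambda>t f. payoff f (\<sigma> t) (Offer X M) h q None)"
    by (rule two_stage_mono) (use Offer.prems(3) x in auto)
  then show ?case by blast
qed

section \<open>Construction of the four-stage mechanism and its strategies\<close>

theorem theorem9:
  fixes \<mu> :: "'s::finite pmf" and \<rho> :: "'t::finite pmf"
    and v :: "'s \<Rightarrow> 'a::finite \<Rightarrow> real" and u :: "'t \<Rightarrow> 's \<Rightarrow> 'a \<Rightarrow> real"
    and M :: "('s, 't, 'g, 'o) mech" and \<sigma> :: "'t \<Rightarrow> ('t, 'g, 'o, 'a) strategy"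
  assumes "valid_mech M" and "optimal_strategies \<mu> u M \<sigma>"
  shows "\<exists>(M' :: ('s, 't, 't + 'a, 't) mech) (\<sigma>' :: 't \<Rightarrow> ('t, 't + 'a, 't, 'a) strategy).
    valid_mech M' \<and> ESES M' \<and> optimal_strategies \<mu> u M' \<sigma>' \<and>
    principal_payoff \<mu> \<rho> v M' \<sigma>' = principal_payoff \<mu> \<rho> v M \<sigma> \<and>
    (\<exists>S \<pi> E C \<pi>' L.
      \<comment> \<open>(i)\<close>
      M' = Offer UNIV S \<and>
      (\<forall>i. S i = Signal (range Inl) (\<pi> i) (E i)) \<and>
      (\<forall>i. choice (\<sigma>' i) [] = i) \<and>
      \<comment> \<open>(ii)\<close>
      (\<forall>i j. E i (Inl j) = Elicit (C i j)) \<and>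
      (\<forall>i j. report (\<sigma>' i) [Chosen i, Sent (Inl j)] = j) \<and>
      \<comment> \<open>(iii)\<close>
      (\<forall>i j k. C i j k = Signal (range Inr) (\<pi>' i j k) (L i j k)) \<and>
      (\<forall>i j k a.
        a \<in> optimal_actions (u k)
              (posterior (posterior (pmf \<mu>) (\<pi> i) (Inl j)) (\<pi>' i j k) (Inr a)) \<and>
        (\<forall>t\<in>{i, k}. act (\<sigma>' t) [Chosen i, Sent (Inl j), Reported k, Sent (Inr a)] = a)))"
proof -
  let ?m = "pmf \<mu>"
  have opt: "optimal_play u t (\<sigma> t) M [] ?m None" for t
    using assms(2) by (simp add: optimal_strategies_def)
  let ?V = "\<lambda>t f. payoff f (\<sigma> t) M [] ?m None"
  have "\<exists>R D W. two_stage u i ?m R D W ?V" for i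
    using assms(1) opt by (intro ex_two_stage) auto
  then obtain R D W where two: "\<And>i. two_stage u i ?m (R i) (D i) (W i) ?V" by metis
  have R0: "0 \<le> R i j \<theta>" and Rsum: "(\<Sum>j\<in>UNIV. R i j \<theta>) = ?m \<theta>"
    and dir: "direct u i k (R i j) (D i j k) (W i j k)" for i j k \<theta>
    using two[of i] by (auto simp: two_stage_def)
  have D0: "0 \<le> D i j k a \<theta>" and Dsum: "(\<Sum>a\<in>UNIV. D i j k a \<theta>) = R i j \<theta>"
    and fav: "a \<in> favored_actions u i k (D i j k a)" for i j k a \<theta>
    using dir[of i k j] by (auto simp: direct_def)
  have optD: "a \<in> optimal_actions (u k) (D i j k a)" for i j k a
    using fav by (rule favored_actions_optimal)

  \<comment> \<open>The parts \<open>R i j\<close> of the prior become the signals at the first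
    stage, and the parts \<open>D i j k a\<close> of \<open>R i j\<close> those at the
    second.\<close>
  have "\<exists>\<pi> :: 's \<Rightarrow> 't pmf. \<forall>\<theta> j. ?m \<theta> * pmf (\<pi> \<theta>) j = R i j \<theta>" for i
    using kernel_of_decomposition[of "R i" ?m] R0 Rsum by metis
  then obtain \<pi>0 :: "'t \<Rightarrow> 's \<Rightarrow> 't pmf" where \<pi>0: "\<And>i \<theta> j. ?m \<theta> * pmf (\<pi>0 i \<theta>) j = R i j \<theta>"
    by metis
  have "\<exists>\<pi> :: 's \<Rightarrow> 'a pmf. \<forall>\<theta> a. R i j \<theta> * pmf (\<pi> \<theta>) a = D i j k a \<theta>" for i j k
    using kernel_of_decomposition[of "D i j k" "R i j"] D0 Dsum by metis
  then obtain \<pi>1 :: "'t \<Rightarrow> 't \<Rightarrow> 't \<Rightarrow> 's \<Rightarrow> 'a pmf"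
    where \<pi>1: "\<And>i j k \<theta> a. R i j \<theta> * pmf (\<pi>1 i j k \<theta>) a = D i j k a \<theta>"
    by metis
  define \<pi> :: "'t \<Rightarrow> 's \<Rightarrow> ('t + 'a) pmf" where "\<pi> i \<theta> = map_pmf Inl (\<pi>0 i \<theta>)" for i \<theta>
  define \<pi>' :: "'t \<Rightarrow> 't \<Rightarrow> 't \<Rightarrow> 's \<Rightarrow> ('t + 'a) pmf"
    where "\<pi>' i j k \<theta> = map_pmf Inr (\<pi>1 i j k \<theta>)" for i j k \<theta>
  have \<pi>: "?m \<theta> * pmf (\<pi> i \<theta>) (Inl j) = R i j \<theta>" for i j \<theta>
    by (simp add: \<pi>_def pmf_map_inj' \<pi>0)
  have \<pi>': "R i j \<theta> * pmf (\<pi>' i j k \<theta>) (Inr a) = D i j k a \<theta>" for i j k a \<theta>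
    by (simp add: \<pi>'_def pmf_map_inj' \<pi>1)

  \<comment> \<open>Types \<open>i\<close> and \<open>k\<close> follow the recommendation. For
    \<open>i\<close> this is \<open>fav\<close>; for \<open>k\<close> all actions optimal for
    \<open>k\<close> are ties.\<close>
  define \<beta> where "\<beta> t i j k a =
      (if t \<in> {i, k} then a else SOME b. b \<in> favored_actions u t k (D i j k a))" for t i j k a
  have \<beta>_fav: "\<beta> t i j k a \<in> favored_actions u t k (D i j k a)" for t i j k a
    using fav[of a i k j] favored_actions_self[of a u k "D i j k a", OF optD]
      some_in_eq[of "favored_actions u t k (D i j k a)"] favored_actions_nonempty[of u t k "D i j k a"]
    by (auto simp: \<beta>_def)
  have \<beta>_own: "\<beta> t i j k a = a" if "t \<in> {i, k}" for t i j k a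
    using that by (simp add: \<beta>_def)
  \<comment> \<open>The payoff in the new mechanism after a report of \<open>k\<close>. It equals
    \<open>W\<close> for type \<open>i\<close> and every \<open>f\<close>, and is at most
    \<open>W\<close> for any type's own payoff function.\<close>
  define K where "K f t i j k = (\<Sum>a\<in>UNIV. exp_util f (D i j k a) (\<beta> t i j k a))" for f t i j k
  have K_own: "K f i i j k = W i j k i f" for f i j k
    using dir[of i k j] by (simp add: K_def \<beta>_own direct_def)
  have K_le: "K (u t) t i j k \<le> W i j k t (u t)" for t i j k
    using dir[of i k j] favored_actions_optimal[OF \<beta>_fav] by (simp add: K_def direct_def)
  \<comment> \<open>A best report of type \<open>t\<close> at the node for \<open>i\<close> and
    \<open>j\<close>; for \<open>t = i\<close> the recommended \<open>j\<close> is a maximiser and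
    can be selected.\<close>
  have "\<exists>l. (\<forall>k. K (u t) t i j k \<le> K (u t) t i j l) \<and> (t = i \<longrightarrow> l = j)" for t i j
  proof (cases "t = i")
    case True
    then show ?thesis using two[of i] by (simp add: K_own two_stage_def)
  next
    case False
    then show ?thesis using ex_maximal[of UNIV "K (u t) t i j"] by simp
  qed
  then obtain \<kappa> where \<kappa>_best: "\<And>t i j k. K (u t) t i j k \<le> K (u t) t i j (\<kappa> t i j)"
    and \<kappa>_own: "\<And>i j. \<kappa> i i j = j"
    by metis

  define C :: "'t \<Rightarrow> 't \<Rightarrow> 't \<Rightarrow> ('s, 't, 't + 'a, 't) mech"
    where "C i j k = Signal (range Inr) (\<pi>' i j k) (\<lambda>_. Leaf)" for i j k
  define E :: "'t \<Rightarrow> 't + 'a \<Rightarrow> ('s, 't, 't + 'a, 't) mech"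
    where "E i g = Elicit (C i (projl g))" for i g
  define S where "S i = Signal (range Inl) (\<pi> i) (E i)" for i
  \<comment> \<open>Paths outside these patterns do not occur at a node of the new tree where that
    kind of move is due.\<close>
  define \<sigma>' :: "'t \<Rightarrow> ('t, 't + 'a, 't, 'a) strategy" where
    "\<sigma>' t = Strategy
       (\<lambda>h. case h of [Chosen i, Sent (Inl j)] \<Rightarrow> \<kappa> t i j)
       (\<lambda>h. t)
       (\<lambda>h. case h of [Chosen i, Sent (Inl j), Reported k, Sent (Inr a)] \<Rightarrow> \<beta> t i j k a)" for t

  have payC: "payoff f (\<sigma>' t) (C i j k) [Chosen i, Sent (Inl j), Reported k] (R i j) (Some k)
      = K f t i j k" for f t i j k
    by (simp add: C_def payoff_Signal R0 sum.reindex \<pi>' K_def \<sigma>'_def del: payoff.simps(2))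
  have payS: "payoff f (\<sigma>' t) (S i) [Chosen i] ?m None = (\<Sum>j\<in>UNIV. K f t i j (\<kappa> t i j))" for f t i
    by (simp add: S_def E_def payoff_Signal sum.reindex \<pi> Let_def payC del: payoff.simps(2))
      (simp add: \<sigma>'_def payC[unfolded \<sigma>'_def])
  \<comment> \<open>Used with \<open>f = v\<close> for the principal's payoff and with
    \<open>f = u t\<close> for incentives at the root.\<close>
  have payS_own: "payoff f (\<sigma>' t) (S t) [Chosen t] ?m None = ?V t f" for f t
    using two[of t] by (simp add: payS K_own \<kappa>_own two_stage_def)
  have payS_le: "payoff (u t) (\<sigma>' t) (S i) [Chosen i] ?m None \<le> ?V t (u t)" for t i
  proof -
    have "(\<Sum>j\<in>UNIV. K (u t) t i j (\<kappa> t i j)) \<le> (\<Sum>j\<in>UNIV. W i j (\<kappa> t i j) t (u t))"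
      by (intro sum_mono K_le)
    also have "\<dots> \<le> ?V t (u t)"
      using two[of i] by (simp add: two_stage_def)
    finally show ?thesis by (simp add: payS)
  qed
  have optC: "optimal_play u t (\<sigma>' t) (C i j k) [Chosen i, Sent (Inl j), Reported k] (R i j) (Some k)"
    for t i j k
    using \<beta>_fav
    by (auto simp: C_def optimal_play_Signal R0 \<pi>' \<sigma>'_def credible_actions_def favored_actions_def
        simp del: optimal_play.simps(2))
  have optS: "optimal_play u t (\<sigma>' t) (S i) [Chosen i] ?m None" for t i
    using \<kappa>_best
    by (auto simp: S_def E_def optimal_play_Signal \<pi> optC payC simp del: optimal_play.simps(2))
      (simp add: \<sigma>'_def)
  have choice: "choice (\<sigma>' t) h = t" for t h
    by (simp add: \<sigma>'_def)
  have opt': "optimal_strategies \<mu> u (Offer UNIV S) \<sigma>'"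
    by (simp add: optimal_strategies_def choice optS payS_own payS_le)
  have pay': "principal_payoff \<mu> \<rho> v (Offer UNIV S) \<sigma>' = principal_payoff \<mu> \<rho> v M \<sigma>"
    by (simp add: principal_payoff_def choice payS_own)
  have valid: "valid_mech (Offer UNIV S)"
    by (auto simp: S_def E_def C_def \<pi>_def \<pi>'_def)
  have eses: "ESES (Offer UNIV S)"
    by (auto simp: ESES_def S_def E_def C_def)
  have rec: "a \<in> optimal_actions (u k) (posterior (posterior ?m (\<pi> i) (Inl j)) (\<pi>' i j k) (Inr a))"
    for i j k a
  proof (rule optimal_actions_posterior)
    \<comment> \<open>The first normalisation contributes only a nonnegative constant, which is 0
      for a null signal.\<close>
    have "a \<in> optimal_actions (u k) (\<lambda>\<theta>. 1 / signal_prob ?m (\<pi> i) (Inl j) * D i j k a \<theta>)"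
      using optD by (intro optimal_actions_scaleI) (auto simp: signal_prob_nonneg)
    then show "a \<in> optimal_actions (u k) (\<lambda>\<theta>. posterior ?m (\<pi> i) (Inl j) \<theta> * pmf (\<pi>' i j k \<theta>) (Inr a))"
      by (simp add: posterior_def \<pi> \<pi>')
  qed (simp add: posterior_nonneg)
  show ?thesis
    by (rule exI[of _ "Offer UNIV S"], rule exI[of _ \<sigma>'], intro conjI exI[of _ S] exI[of _ \<pi>]
        exI[of _ E] exI[of _ C] exI[of _ \<pi>'] exI[of _ "\<lambda>i j k _. Leaf"])
      (simp_all only: valid eses opt' pay', auto simp: choice rec S_def E_def C_def \<sigma>'_def \<kappa>_own \<beta>_own)
qed

end
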